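(* For real numbers $\ell \ge 0$ and $x,y > 1$, let $$F(\ell,x,y) = \sinh(\ell)^3xy - \left(\cosh(\ell)^3-3\cosh(\ell)+2\right)(x+y) + \sinh(\ell)^3 - 6\sinh(\ell) - 6\ell + 6\operatorname{arctanh}\left(\frac1x\right) + \frac{2x}{x^2-1} + 6\operatorname{arctanh}\left(\frac1y\right) + \frac{2y}{y^2-1}.$$ Then $F(\ell,x,y)\ge 0$ for all $\ell \ge 0$ and $x,y > 1$, and $F(\ell,x,y)=0$ only when $x = y = \coth(\ell/2)$.
   Context: Here $\operatorname{arctanh}(t)=\tfrac12\ln\frac{1+t}{1-t}$ for $|t|<1$. For $\ell=0$ the convention is $\coth(0)=\infty$, so the assertion for $\ell=0$ is that $F(0,x,y)$ does not vanish for any finite $x,y>1$. *)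

theory Defs
  imports Complex_Main
begin

definition coth :: "real \<Rightarrow> real" where
  "coth t = cosh t / sinh t"  \<comment> \<open>meaningful only for \<open>t \<noteq> 0\<close>; division by zero makes \<open>coth 0 = 0\<close>\<close>

definition F :: "real \<Rightarrow> real \<Rightarrow> real \<Rightarrow> real" where
  "F l x y =
     sinh l ^ 3 * x * y
     - (cosh l ^ 3 - 3 * cosh l + 2) * (x + y)
     + sinh l ^ 3 - 6 * sinh l - 6 * l
     + 6 * artanh (1 / x) + 2 * x / (x\<^sup>2 - 1)
     + 6 * artanh (1 / y) + 2 * y / (y\<^sup>2 - 1)"

end

theory Submission
  imports Defs
begin

text \<open>
  Put \<open>x = coth a\<close> and \<open>y = coth b\<close> with \<open>a, b > 0\<close>. For fixed \<open>l\<close> and \<open>s = a + b\<close>, the function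
  depends on \<open>a\<close> and \<open>b\<close> only through \<open>v = 2 sinh a sinh b\<close>, as \<open>w / v - 2 v sinh s\<close> plus a constant,
  with \<open>w \<ge> 0\<close>. This decreases in \<open>v = cosh s - cosh (a - b)\<close>, so it is smallest exactly at \<open>a = b\<close>.
  On the diagonal \<open>a = b = s / 2\<close> the derivative in \<open>l\<close> has the sign of \<open>l - s\<close>, and the value at
  \<open>l = s\<close> is zero.
\<close>

text \<open>This licenses the substitution \<open>x = coth a\<close>: exponentiating the logarithm
  in \<open>artanh\<close> gives \<open>exp (2 * a) = (x + 1) / (x - 1)\<close>, which solved for
  \<open>x\<close> is \<open>coth a\<close>.\<close>

lemma coth_artanh_inverse:
  fixes x :: real
  assumes "x > 1"
  shows "artanh (1 / x) > 0" and "coth (artanh (1 / x)) = x"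
proof -
  let ?a = "artanh (1 / x)"
  have quot: "(1 + 1 / x) / (1 - 1 / x) = (x + 1) / (x - 1)"
    using assms by (simp add: field_simps)
  have e: "exp (2 * ?a) = (x + 1) / (x - 1)"
    using assms by (simp add: artanh_def quot)
  also have "\<dots> > 1" using assms by (simp add: field_simps)
  finally show pos: "?a > 0" by simp
  have "exp (2 * ?a) * (x - 1) = x + 1" using e assms by simp
  moreover have "exp (2 * ?a) = exp ?a * exp ?a" by (simp flip: exp_add)
  ultimately have "cosh ?a = x * sinh ?a"
    by (simp add: cosh_field_def sinh_field_def exp_minus field_simps)
  then show "coth ?a = x" using pos by (simp add: coth_def)
qed

lemma artanh_inverse_coth:
  fixes a :: real
  assumes "a > 0"
  shows "artanh (1 / coth a) = a"
  using artanh_tanh_real[of a] by (simp add: coth_def tanh_def)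

lemma two_sinh_mult_self:
  fixes c :: real
  shows "2 * sinh c * sinh c = cosh (c + c) - 1"
  using cosh_square_eq[of c] by (simp only: cosh_add) (simp add: power2_eq_square)

text \<open>The \<open>artanh\<close> terms become linear, the rational terms become
  \<open>sinh (2 * a)\<close> and \<open>sinh (2 * b)\<close>, and addition formulas collect the
  rest. The product \<open>2 * sinh a * sinh b\<close> is kept intact as the only quantity that
  varies when \<open>a + b\<close> is fixed.\<close>

lemma F_coth:
  fixes l a b :: real
  assumes "a > 0" and "b > 0"
  shows "F l (coth a) (coth b) =
    2 * (sinh l ^ 3 * cosh (a + b) - (cosh l ^ 3 - 3 * cosh l + 2) * sinh (a + b))
      / (2 * sinh a * sinh b)
    - 2 * sinh (a + b) * (2 * sinh a * sinh b)
    + 2 * sinh (a + b) * cosh (a + b) + 6 * (a + b - l) - 6 * sinh l"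
proof -
  have rational: "2 * coth t / ((coth t)\<^sup>2 - 1) = 2 * sinh t * cosh t" if "t > 0" for t
  proof -
    have "(coth t)\<^sup>2 - 1 = 1 / (sinh t)\<^sup>2"
      using that cosh_square_eq[of t] by (simp add: coth_def field_simps)
    then show ?thesis using that by (simp add: coth_def power2_eq_square)
  qed
  define A B where AB: "A = sinh a" "B = sinh b"
  define C D where CD: "C = cosh a" "D = cosh b"
  have nz: "A \<noteq> 0" "B \<noteq> 0" using assms by (auto simp: AB)
  have sq: "C\<^sup>2 = A\<^sup>2 + 1" "D\<^sup>2 = B\<^sup>2 + 1"
    by (simp_all add: AB CD cosh_square_eq)
  define S P where SP: "S = sinh l ^ 3" "P = cosh l ^ 3 - 3 * cosh l + 2"
  \<comment> \<open>This is \<open>sinh (2 * a) + sinh (2 * b) = 2 * sinh (a + b) * cosh (a -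
    b)\<close>, with \<open>cosh (a - b)\<close> rewritten as
    \<open>cosh (a + b) - 2 * sinh a * sinh b\<close>.\<close>
  have polynomial: "2 * A * C + 2 * B * D
      = 2 * (A * D + C * B) * (C * D + A * B) - 2 * (A * D + C * B) * (2 * A * B)"
    using sq by algebra
  have fractions: "S * (C / A) * (D / B) - P * (C / A + D / B) + S
      = 2 * (S * (C * D + A * B) - P * (A * D + C * B)) / (2 * A * B)"
    using nz by (simp add: field_simps)
  have "F l (coth a) (coth b) =
    (S * (C / A) * (D / B) - P * (C / A + D / B) + S)
      + (2 * A * C + 2 * B * D) + 6 * (a + b - l) - 6 * sinh l"
    using assms
    by (simp add: F_def rational artanh_inverse_coth) (simp add: coth_def AB CD SP)
  then show ?thesis
    unfolding polynomial fractions sinh_add cosh_add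
      AB[symmetric] CD[symmetric] SP[symmetric] by simp
qed

text \<open>Since \<open>sinh s \<le> cosh s\<close>, it suffices to compare the two coefficients.
  They factor as \<open>(C - 1) * (C + 1) * S\<close> and \<open>(C - 1)\<^sup>2 * (C + 2)\<close>;
  after removing \<open>C - 1\<close>, squaring eliminates \<open>S\<close>.\<close>

lemma weight_nonneg:
  fixes l s :: real
  assumes "l \<ge> 0" and "s \<ge> 0"
  shows "sinh l ^ 3 * cosh s - (cosh l ^ 3 - 3 * cosh l + 2) * sinh s \<ge> 0"
proof -
  define C S where "C = cosh l" and "S = sinh l"
  have C: "C \<ge> 1" and S: "S \<ge> 0" and SC: "S\<^sup>2 = C\<^sup>2 - 1"
    using assms by (auto simp: C_def S_def cosh_real_ge_1 cosh_square_eq)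
  have "((C - 1) * (C + 2))\<^sup>2 \<le> (S * (C + 1))\<^sup>2"
  proof -
    have "(S * (C + 1))\<^sup>2 - ((C - 1) * (C + 2))\<^sup>2 = (C - 1) * (3 * C + 5)"
      using SC by algebra
    also have "\<dots> \<ge> 0" using C by simp
    finally show ?thesis by simp
  qed
  then have "(C - 1) * (C + 2) \<le> S * (C + 1)"
    using C S by (intro power2_le_imp_le[of "(C - 1) * (C + 2)"]) auto
  then have "(C - 1) * ((C - 1) * (C + 2)) \<le> (C - 1) * (S * (C + 1))"
    using C by (intro mult_left_mono) auto
  moreover have "(C - 1) * (S * (C + 1)) = S ^ 3" using SC by algebra
  moreover have "(C - 1) * ((C - 1) * (C + 2)) = C ^ 3 - 3 * C + 2" by algebra
  ultimately have "C ^ 3 - 3 * C + 2 \<le> S ^ 3" by simp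
  moreover have "sinh s \<le> cosh s" by (simp add: sinh_le_cosh_real)
  ultimately have "(C ^ 3 - 3 * C + 2) * sinh s \<le> S ^ 3 * cosh s"
    using assms S by (intro mult_mono) auto
  then show ?thesis by (simp add: C_def S_def)
qed

lemma F_coth_midpoint_less:
  fixes l a b :: real
  assumes "l \<ge> 0" and "a > 0" and "b > 0" and "a \<noteq> b"
  shows "F l (coth ((a + b) / 2)) (coth ((a + b) / 2)) < F l (coth a) (coth b)"
proof -
  define c where "c = (a + b) / 2"
  have c: "c > 0" "c + c = a + b" using assms by (auto simp: c_def)
  define w where "w = 2 * (sinh l ^ 3 * cosh (a + b) - (cosh l ^ 3 - 3 * cosh l + 2) * sinh (a + b))"
  have w: "w \<ge> 0" using weight_nonneg[of l "a + b"] assms by (simp add: w_def)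
  define u v where "u = 2 * sinh a * sinh b" and "v = 2 * sinh c * sinh c"
  have u: "u = cosh (a + b) - cosh (a - b)" by (simp add: u_def cosh_add cosh_diff)
  have v: "v = cosh (a + b) - 1"
    by (simp add: v_def two_sinh_mult_self c(2))
  have "cosh (a - b) > 1"
    using assms cosh_real_ge_1[of "a - b"] cosh_real_one_iff[of "a - b"] by linarith
  then have uv: "u < v" using u v by simp
  have u0: "u > 0" using assms by (simp add: u_def)
  have "w / v \<le> w / u" using w uv u0 by (intro divide_left_mono) auto
  \<comment> \<open>Strictness has to come from this term, because \<open>w\<close> vanishes at
    \<open>l = 0\<close>.\<close>
  moreover have "sinh (a + b) * u < sinh (a + b) * v" using uv assms by simp
  ultimately show ?thesis
    using F_coth[OF assms(2,3), of l] F_coth[OF c(1,1), of l]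
    unfolding c(2) w_def[symmetric] u_def[symmetric] v_def[symmetric] c_def[symmetric] by linarith
qed

lemma F_coth_half_zero:
  fixes s :: real
  assumes "s > 0"
  shows "F s (coth (s / 2)) (coth (s / 2)) = 0"
proof -
  define c where "c = s / 2"
  have c: "c > 0" "c + c = s" using assms by (auto simp: c_def)
  define C S where "C = cosh s" and "S = sinh s"
  have SC: "S\<^sup>2 = C\<^sup>2 - 1" by (simp add: C_def S_def cosh_square_eq)
  have v: "2 * sinh c * sinh c = C - 1"
    by (simp add: C_def two_sinh_mult_self c(2))
  have C1: "C > 1"
    using assms cosh_real_ge_1[of s] cosh_real_one_iff[of s] unfolding C_def by linarith
  \<comment> \<open>After division by \<open>C - 1\<close>, every remaining term is a multiple of
    \<open>S\<close>, and the factors \<open>4 - 2 * (C - 1) + 2 * C - 6\<close> cancel.\<close>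
  have "2 * (S ^ 3 * C - (C ^ 3 - 3 * C + 2) * S) = 4 * S * (C - 1)"
    using SC by algebra
  then have "2 * (S ^ 3 * C - (C ^ 3 - 3 * C + 2) * S) / (C - 1) = 4 * S"
    using C1 by simp
  then show ?thesis
    using F_coth[OF c(1,1), of s] unfolding v c(2)
    by (simp add: algebra_simps flip: C_def S_def c_def)
qed

text \<open>The difference of the two sides is the factor that decides the sign of the derivative of
  \<open>F\<close> in \<open>l\<close> on the diagonal.\<close>

lemma derivative_sign:
  fixes l s :: real
  assumes "l > 0" and "s > 0"
  shows "l < s \<Longrightarrow> (cosh l - 1) * cosh (s - l) < cosh s - 1"
    and "l > s \<Longrightarrow> (cosh l - 1) * cosh (s - l) > cosh s - 1"
proof -
  have *: "(cosh l - 1) * cosh (s - l) - (cosh s - 1) = 1 - cosh (l - s) + sinh l * sinh (l - s)"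
    using cosh_add[of "s - l" l] sinh_minus[of "s - l"] cosh_minus[of "s - l"]
    by (simp add: algebra_simps)
  show "(cosh l - 1) * cosh (s - l) < cosh s - 1" if "l < s"
  proof -
    have "sinh l * sinh (l - s) < 0" using that assms by (simp add: mult_pos_neg)
    then show ?thesis using * cosh_real_ge_1[of "l - s"] by linarith
  qed
  show "(cosh l - 1) * cosh (s - l) > cosh s - 1" if "l > s"
  proof -
    \<comment> \<open>As \<open>s > 0\<close> gives \<open>p < l\<close>, the factor
      \<open>sinh l\<close> can be lowered to \<open>sinh p\<close>, and
      \<open>sinh p * sinh p = (cosh p - 1) * (cosh p + 1)\<close> exceeds
      \<open>cosh p - 1\<close>.\<close>
    define p where "p = l - s"
    have p: "0 < p" "p < l" using that assms by (auto simp: p_def)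
    have c: "cosh p > 1" using p cosh_real_ge_1[of p] cosh_real_one_iff[of p] by linarith
    have "(cosh p - 1) * (cosh p + 1) = sinh p * sinh p"
      using hyperbolic_pythagoras[of p] by (simp add: power2_eq_square algebra_simps)
    moreover have "\<dots> < sinh l * sinh p" using p by simp
    moreover have "(cosh p - 1) * 1 < (cosh p - 1) * (cosh p + 1)"
      using c by (intro mult_strict_left_mono) auto
    ultimately have "cosh p - 1 < sinh l * sinh p" by simp
    then have "1 - cosh (l - s) + sinh l * sinh (l - s) > 0" unfolding p_def by simp
    then show ?thesis using * by simp
  qed
qed

lemma F_coth_half_derivative:
  fixes l s :: real
  assumes "s > 0"
  shows "((\<lambda>l. F l (coth (s / 2)) (coth (s / 2))) has_real_derivative
    6 * (cosh l + 1) * ((cosh l - 1) * cosh (s - l) - (cosh s - 1)) / (cosh s - 1)) (at l)"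
proof -
  define c where "c = s / 2"
  have c: "c > 0" "c + c = s" using assms by (auto simp: c_def)
  define v where "v = cosh s - 1"
  have sinh_c: "2 * sinh c * sinh c = v"
    by (simp add: v_def two_sinh_mult_self c(2))
  have v: "v \<noteq> 0" using assms by (simp add: v_def)
  \<comment> \<open>The inner bracket is \<open>3 * sinh l ^ 3\<close>, so the first summand is
    \<open>6 * sinh l ^ 2 * cosh (s - l)\<close>, and \<open>sinh l ^ 2\<close> contains the common
    factor \<open>cosh l + 1\<close>.\<close>
  have "2 * (3 * sinh l ^ 2 * cosh l * cosh s - (3 * cosh l ^ 2 * sinh l - 3 * sinh l) * sinh s)
      - 6 * (cosh l + 1) * v = 6 * (cosh l + 1) * ((cosh l - 1) * cosh (s - l) - v)"
    using cosh_square_eq[of l] unfolding cosh_diff by algebra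
  then have *: "2 * (3 * sinh l ^ 2 * cosh l * cosh s - (3 * cosh l ^ 2 * sinh l - 3 * sinh l) * sinh s) / v
      - 6 * (cosh l + 1) = 6 * (cosh l + 1) * ((cosh l - 1) * cosh (s - l) - v) / v"
    using v by (simp add: field_simps)
  show ?thesis
    unfolding c_def[symmetric] F_coth[OF c(1,1)] sinh_c c(2) v_def[symmetric] *[symmetric]
    using v by (auto intro!: derivative_eq_intros simp: field_simps)
qed

lemma F_coth_half_pos:
  fixes l s :: real
  assumes "l \<ge> 0" and "s > 0" and "l \<noteq> s"
  shows "F l (coth (s / 2)) (coth (s / 2)) > 0"
proof -
  let ?f = "\<lambda>l. F l (coth (s / 2)) (coth (s / 2))"
  note deriv = F_coth_half_derivative[OF assms(2)]
  have cont: "continuous_on S ?f" for S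
    using DERIV_isCont[OF deriv] by (auto intro: continuous_at_imp_continuous_on)
  have K: "cosh s - 1 > 0" 
    using assms cosh_real_ge_1[of s] cosh_real_one_iff[of s] by linarith
  have C: "6 * (cosh t + 1) > 0" for t :: real
    using cosh_real_ge_1[of t] by simp
  show ?thesis
  proof (cases "l < s")
    case True
    have "?f s < ?f l"
    \<comment> \<open>Only interior points need a sign: the derivative vanishes at \<open>s\<close>,
      and \<open>t > 0\<close> holds even if \<open>l = 0\<close>.\<close>
    proof (rule DERIV_neg_imp_decreasing_open[OF True _ cont])
      fix t assume t: "l < t" "t < s"
      then have "6 * (cosh t + 1) * ((cosh t - 1) * cosh (s - t) - (cosh s - 1)) / (cosh s - 1) < 0"
        using derivative_sign(1)[of t s] assms
        by (intro divide_neg_pos[OF _ K] mult_pos_neg[OF C]) auto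
      with deriv show "\<exists>y. DERIV ?f t :> y \<and> y < 0" by blast
    qed
    then show ?thesis using F_coth_half_zero[OF assms(2)] by simp
  next
    case False
    then have "s < l" using assms by simp
    then have "?f s < ?f l"
    proof (rule DERIV_pos_imp_increasing_open[OF _ _ cont])
      fix t assume t: "s < t" "t < l"
      then have "6 * (cosh t + 1) * ((cosh t - 1) * cosh (s - t) - (cosh s - 1)) / (cosh s - 1) > 0"
        using derivative_sign(2)[of t s] assms
        by (intro divide_pos_pos[OF _ K] mult_pos_pos[OF C]) auto
      with deriv show "\<exists>y. DERIV ?f t :> y \<and> y > 0" by blast
    qed
    then show ?thesis using F_coth_half_zero[OF assms(2)] by simp
  qed
qed

theorem lemma2:
  fixes l x y :: real
  assumes "l \<ge> 0" and "x > 1" and "y > 1"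
  shows "F l x y \<ge> 0 \<and>
         (F l x y = 0 \<longrightarrow> l \<noteq> 0 \<and> x = coth (l / 2) \<and> y = coth (l / 2))"
proof -
  define a b where "a = artanh (1 / x)" and "b = artanh (1 / y)"
  have a: "a > 0" "coth a = x" and b: "b > 0" "coth b = y"
    using coth_artanh_inverse assms by (auto simp: a_def b_def)
  have mid: "F l (coth ((a + b) / 2)) (coth ((a + b) / 2)) \<ge> 0"
    using F_coth_half_pos[of l "a + b"] F_coth_half_zero[of "a + b"] a b assms(1)
    by (cases "l = a + b") auto
  show ?thesis
  proof (cases "a = b")
    case True
    then have "l \<noteq> a + b \<Longrightarrow> F l x y > 0"
      using F_coth_half_pos[of l "a + b"] a b assms(1) by simp
    \<comment> \<open>A zero forces \<open>l = a + b = 2 * a\<close>, so \<open>l > 0\<close> and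
      \<open>a = b = l / 2\<close>. The conjunct \<open>l \<noteq> 0\<close> expresses the
      convention that \<open>coth\<close> is infinite at 0, where the formal value is 0.\<close>
    then show ?thesis using mid True a b by (cases "l = a + b") auto
  next
    case False
    then have "F l x y > 0"
      using F_coth_midpoint_less[OF assms(1) a(1) b(1)] mid a(2) b(2) by simp
    then show ?thesis by simp
  qed
qed

end
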